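(* Let $\mathcal I$ be a strictly proper ideal of subsets of $\Omega$. There exists $P\in\Delta_{BD}$ such that $P(E)=0$ for every $E\in\mathcal I\cap\Sigma$.
   Context: Let $\Omega=\{0,1\}^{\mathbb N}$ (paths); for $\omega\in\Omega$, $t\ge0$, $\omega^t$ is the cylinder of paths agreeing with $\omega$ in the first $t$ coordinates. $\Sigma$ is a fixed $\sigma$-algebra on $\Omega$ containing all cylinders, and $\mathbb P$ the set of finitely additive probabilities on $(\Omega,\Sigma)$. $P\in\mathbb P$ is strongly nonatomic if for every $E\in\Sigma$ and $\alpha\in[0,1]$ there is $F\in\Sigma$, $F\subseteq E$, with $P(F)=\alpha P(E)$. For $R\in\mathbb P$ and a cylinder with $R(\omega^t)>0$, $R(E\mid\omega^t)=R(E\cap\omega^t)/R(\omega^t)$. $P$ merges with $Q$ if for every $\varepsilon>0$, $Q(\{\omega:\sup_{E\in\Sigma}|P(E\mid\omega^t)-Q(E\mid\omega^t)|>\varepsilon\})\to0$ as $t\to\infty$ (cylinders with $Q(\omega^t)>0=P(\omega^t)$ counted in the set). $Q\ll P$ means: for every sequence $(E_n)$ in $\Sigma$, $P(E_n)\to0$ implies $Q(E_n)\to0$. $P$ has the Blackwell–Dubins property if it merges with every $Q\in\mathbb P$ with $Q\ll P$; $\Delta_{BD}$ is the set of strongly nonatomic $P\in\mathbb P$ with this property. A collection $\mathcal I$ of subsets of $\Omega$ is a strictly proper ideal if (1) $S\in\mathcal I$, $R\subseteq S$ imply $R\in\mathcal I$; (2) $R,S\in\mathcal I$ imply $R\cup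 S\in\mathcal I$; (3) no cylinder belongs to $\mathcal I$. *)

theory Defs
  imports "HOL-Analysis.Analysis"
begin

type_synonym path = "nat \<Rightarrow> bool"

definition cyl :: "path \<Rightarrow> nat \<Rightarrow> path set" where
  "cyl \<omega> t = {\<omega>'. \<forall>i<t. \<omega>' i = \<omega> i}"

definition admissible_sigma :: "path set set \<Rightarrow> bool" where
  "admissible_sigma S \<longleftrightarrow> sigma_algebra UNIV S \<and> (\<forall>\<omega> t. cyl \<omega> t \<in> S)"

text \<open>Finitely additive probability on (Omega, S); values outside S are irrelevant.\<close>
definition fa_prob :: "path set set \<Rightarrow> (path set \<Rightarrow> real) \<Rightarrow> bool" where
  "fa_prob S P \<longleftrightarrow> (\<forall>E\<in>S. 0 \<le> P E) \<and> P UNIV = 1 \<and>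
     (\<forall>E\<in>S. \<forall>F\<in>S. E \<inter> F = {} \<longrightarrow> P (E \<union> F) = P E + P F)"

definition strongly_nonatomic :: "path set set \<Rightarrow> (path set \<Rightarrow> real) \<Rightarrow> bool" where
  "strongly_nonatomic S P \<longleftrightarrow>
     (\<forall>E\<in>S. \<forall>\<alpha>::real. 0 \<le> \<alpha> \<and> \<alpha> \<le> 1 \<longrightarrow> (\<exists>F\<in>S. F \<subseteq> E \<and> P F = \<alpha> * P E))"

definition cond_prob :: "(path set \<Rightarrow> real) \<Rightarrow> path set \<Rightarrow> path \<Rightarrow> nat \<Rightarrow> real" where
  "cond_prob R E \<omega> t = R (E \<inter> cyl \<omega> t) / R (cyl \<omega> t)"

definition bad_set :: "path set set \<Rightarrow> (path set \<Rightarrow> real) \<Rightarrow> (path set \<Rightarrow> real) \<Rightarrow> real \<Rightarrow> nat \<Rightarrow> path set" where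
  "bad_set S P Q \<epsilon> t = {\<omega>. (Q (cyl \<omega> t) > 0 \<and> P (cyl \<omega> t) = 0) \<or>
      (Q (cyl \<omega> t) > 0 \<and> P (cyl \<omega> t) > 0 \<and>
       (SUP E\<in>S. \<bar>cond_prob P E \<omega> t - cond_prob Q E \<omega> t\<bar>) > \<epsilon>)}"

definition merges :: "path set set \<Rightarrow> (path set \<Rightarrow> real) \<Rightarrow> (path set \<Rightarrow> real) \<Rightarrow> bool" where
  "merges S P Q \<longleftrightarrow> (\<forall>\<epsilon>>0. (\<lambda>t. Q (bad_set S P Q \<epsilon> t)) \<longlonglongrightarrow> 0)"

definition abs_cont :: "path set set \<Rightarrow> (path set \<Rightarrow> real) \<Rightarrow> (path set \<Rightarrow> real) \<Rightarrow> bool" where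
  "abs_cont S Q P \<longleftrightarrow> (\<forall>En :: nat \<Rightarrow> path set. (\<forall>n. En n \<in> S) \<longrightarrow>
      (\<lambda>n. P (En n)) \<longlonglongrightarrow> 0 \<longrightarrow> (\<lambda>n. Q (En n)) \<longlonglongrightarrow> 0)"

definition blackwell_dubins :: "path set set \<Rightarrow> (path set \<Rightarrow> real) \<Rightarrow> bool" where
  "blackwell_dubins S P \<longleftrightarrow> (\<forall>Q. fa_prob S Q \<and> abs_cont S Q P \<longrightarrow> merges S P Q)"

definition Delta_BD :: "path set set \<Rightarrow> (path set \<Rightarrow> real) set" where
  "Delta_BD S = {P. fa_prob S P \<and> strongly_nonatomic S P \<and> blackwell_dubins S P}"

definition strictly_proper_ideal :: "path set set \<Rightarrow> bool" where
  "strictly_proper_ideal I \<longleftrightarrow>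
     (\<forall>S\<in>I. \<forall>R. R \<subseteq> S \<longrightarrow> R \<in> I) \<and>
     (\<forall>R\<in>I. \<forall>S\<in>I. R \<union> S \<in> I) \<and>
     (\<forall>\<omega> t. cyl \<omega> t \<notin> I)"

end

theory Submission
  imports Defs
begin

text \<open>
  Existence. For each level \<open>t\<close> the fraction of \<open>t\<close>-cylinders that a set meets outside
  the ideal is a monotone submodular set function. Replacing such a \<open>q\<close> by
  \<open>X \<mapsto> q (X \<inter> E) + q (X \<union> E) - q E\<close> only decreases it, so a minimal submodular function below
  all these fractions is additive; it is uniform on cylinders and vanishes on the ideal. The
  requirement that every set be approximated by clopen sets survives both this replacement and
  infima of chains, so the clopen sets are dense for the resulting charge \<open>P\<close>.

  Merging. For \<open>Q\<close> absolutely continuous with respect to \<open>P\<close>, the Hellinger affinity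
  \<open>\<Sum> sqrt (P C * Q C)\<close> over the cylinders \<open>C\<close> of level \<open>t\<close> decreases in \<open>t\<close>, hence converges.
  Splitting a cylinder \<open>C\<close> on which the conditional charges differ by more than \<open>\<epsilon>\<close> costs at least
  \<open>\<epsilon>\<^sup>2 / 4 * sqrt (P C * Q C)\<close>, and by density no finite splitting in the sigma-algebra can go
  below the limit. So such cylinders carry little affinity, and little \<open>Q\<close>-mass outside
  the cylinders with \<open>Q C / P C\<close> large, which are \<open>P\<close>-small and therefore \<open>Q\<close>-small.
\<close>

subsection \<open>Minimal submodular functions\<close>

text \<open>The last conjunct says, once \<open>q\<close> is additive, that \<open>\<A>\<close> is dense for the pseudometric
  \<open>q (X - F) + q (F - X)\<close>; this one-sided form is stable under infima of chains.\<close>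

definition regular_submodular :: "'a set set \<Rightarrow> ('a set \<Rightarrow> real) \<Rightarrow> bool" where
  "regular_submodular \<A> q \<longleftrightarrow> q {} = 0 \<and> mono q \<and>
     (\<forall>X Y. q (X \<union> Y) + q (X \<inter> Y) \<le> q X + q Y) \<and>
     (\<forall>X. \<forall>e>0. \<exists>F\<in>\<A>. q (X - F) < e \<and> q F < q X + e)"

lemma regular_submodularD:
  assumes "regular_submodular \<A> q"
  shows "q {} = 0" and "X \<subseteq> Y \<Longrightarrow> q X \<le> q Y"
    and "q (X \<union> Y) + q (X \<inter> Y) \<le> q X + q Y"
    and "0 \<le> q X" and "q (X \<union> Y) \<le> q X + q Y"
    and "e > 0 \<Longrightarrow> \<exists>F\<in>\<A>. q (X - F) < e \<and> q F < q X + e"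
proof -
  show emp: "q {} = 0" and mono: "\<And>X Y. X \<subseteq> Y \<Longrightarrow> q X \<le> q Y"
    and sub: "\<And>X Y. q (X \<union> Y) + q (X \<inter> Y) \<le> q X + q Y"
    and "e > 0 \<Longrightarrow> \<exists>F\<in>\<A>. q (X - F) < e \<and> q F < q X + e"
    using assms by (auto simp: regular_submodular_def mono_def)
  show pos: "0 \<le> q X" for X using mono[of "{}" X] emp by simp
  show "q (X \<union> Y) \<le> q X + q Y" using sub[of X Y] pos[of "X \<inter> Y"] by linarith
qed

text \<open>Each clause involves finitely many sets up to an error, so one member of the chain
  suffices: for submodularity, the smaller of two members nearly optimal at \<open>X\<close> and at
  \<open>Y\<close>; for approximation, a member nearly optimal at \<open>X\<close>, whose
  \<open>F\<close> still serves because the infimum lies below it.\<close>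

lemma regular_submodular_chain_INF:
  assumes ne: "C \<noteq> {}" and rs: "\<And>q. q \<in> C \<Longrightarrow> regular_submodular \<A> q"
    and chain: "\<And>q r. q \<in> C \<Longrightarrow> r \<in> C \<Longrightarrow> q \<le> r \<or> r \<le> q"
  shows "regular_submodular \<A> (\<lambda>X. INF q\<in>C. q X)"
proof -
  note D = regular_submodularD[OF rs]
  have bdd: "bdd_below ((\<lambda>q. q X) ` C)" for X
    by (rule bdd_belowI2[of _ 0]) (rule D(4))
  define p where "p = (\<lambda>X. INF q\<in>C. q X)"
  have le: "p X \<le> q X" if "q \<in> C" for q X
    unfolding p_def by (rule cINF_lower[OF bdd that])
  have near: "\<exists>q\<in>C. q X < r" if "p X < r" for X r
    using that cINF_less_iff[OF ne bdd] unfolding p_def by blast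
  have "(\<lambda>q. q {}) ` C = {0}" using ne D(1) by force
  then have "p {} = 0" by (simp add: p_def)
  moreover have "mono p" unfolding p_def
    by (intro monoI cINF_mono ne bdd) (use D(2) in blast)
  moreover have "p (X \<union> Y) + p (X \<inter> Y) \<le> p X + p Y" for X Y
  proof (rule field_le_epsilon)
    fix e :: real assume e: "e > 0"
    obtain q r where q: "q \<in> C" "q X < p X + e/2" and r: "r \<in> C" "r Y < p Y + e/2"
      using near[of X "p X + e/2"] near[of Y "p Y + e/2"] e by auto
    obtain s where s: "s \<in> C" "s \<le> q" "s \<le> r" using chain[OF q(1) r(1)] q(1) r(1) by blast
    have "p (X \<union> Y) + p (X \<inter> Y) \<le> s X + s Y"
      using le[OF s(1), of "X \<union> Y"] le[OF s(1), of "X \<inter> Y"] D(3)[OF s(1), of X Y] by linarith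
    also have "\<dots> \<le> q X + r Y" using s by (simp add: add_mono le_funD)
    finally show "p (X \<union> Y) + p (X \<inter> Y) \<le> p X + p Y + e" using q r by linarith
  qed
  moreover have "\<exists>F\<in>\<A>. p (X - F) < e \<and> p F < p X + e" if e: "e > 0" for X e
  proof -
    obtain q where q: "q \<in> C" "q X < p X + e/2" using near[of X "p X + e/2"] e by auto
    obtain F where F: "F \<in> \<A>" "q (X - F) < e/2" "q F < q X + e/2"
      using D(6)[OF q(1), of "e/2" X] e by auto
    show ?thesis using F q le[OF q(1), of "X - F"] le[OF q(1), of F] e
      by (intro bexI[of _ F]) auto
  qed
  ultimately show ?thesis unfolding regular_submodular_def p_def[symmetric] by blast
qed

text \<open>Monotonicity and submodularity pass through because intersection with \<open>E\<close>
  and union with \<open>E\<close> are lattice homomorphisms. Approximation needs work: approximants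
  of \<open>X \<inter> E\<close> and \<open>X \<union> E\<close> are glued along an approximant of
  \<open>E\<close>.\<close>

lemma regular_submodular_modularize:
  assumes q: "regular_submodular \<A> q" and alg: "algebra UNIV \<A>"
  defines "p \<equiv> \<lambda>E X. q (X \<inter> E) + q (X \<union> E) - q E"
  shows "regular_submodular \<A> (p E)"
proof -
  note D = regular_submodularD[OF q]
  have emp: "p E {} = 0" by (simp add: p_def D(1))
  have mono: "p E X \<le> p E Y" if "X \<subseteq> Y" for X Y
    using D(2)[of "X \<inter> E" "Y \<inter> E"] D(2)[of "X \<union> E" "Y \<union> E"] that by (force simp: p_def)
  have submod: "p E (X \<union> Y) + p E (X \<inter> Y) \<le> p E X + p E Y" for X Y
  proof -
    have [simp]: "(X \<inter> E) \<union> (Y \<inter> E) = (X \<union> Y) \<inter> E" "(X \<inter> E) \<inter> (Y \<inter> E) = (X \<inter> Y) \<inter> E"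
      "(X \<union> E) \<union> (Y \<union> E) = (X \<union> Y) \<union> E" "(X \<union> E) \<inter> (Y \<union> E) = (X \<inter> Y) \<union> E" by auto
    show ?thesis
      using D(3)[of "X \<inter> E" "Y \<inter> E"] D(3)[of "X \<union> E" "Y \<union> E"] by (simp add: p_def)
  qed
  have sub: "p E (X \<union> Y) \<le> p E X + p E Y" for X Y
    using submod[of X Y] mono[of "{}" "X \<inter> Y"] emp by auto
  have le: "p E X \<le> q X" for X using D(3)[of X E] by (simp add: p_def)
  have reg: "\<exists>F\<in>\<A>. p E (X - F) < e \<and> p E F < p E X + e" if e: "e > 0" for X e
  proof -
    \<comment> \<open>The errors add up to at most six multiples of \<open>d\<close>, reached as
      \<open>3 * d + d + 2 * d\<close> in the bound on \<open>p E F\<close>.\<close>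
    define d where "d = e/8"
    have d: "d > 0" using e by (simp add: d_def)
    obtain A where A: "A \<in> \<A>" "q (X \<inter> E - A) < d" "q A < q (X \<inter> E) + d" using D(6)[OF d] by blast
    obtain B where B: "B \<in> \<A>" "q (X \<union> E - B) < d" "q B < q (X \<union> E) + d" using D(6)[OF d] by blast
    obtain G where G: "G \<in> \<A>" "q (E - G) < d" "q G < q E + d" using D(6)[OF d] by blast
    \<comment> \<open>\<open>G\<close> stands in for \<open>E\<close>: inside it \<open>A\<close>
      approximates \<open>X \<inter> E\<close>, outside it \<open>B\<close> approximates
      \<open>X \<union> E\<close>.\<close>
    define F where "F = (A \<inter> G) \<union> (B - G)"
    interpret algebra UNIV \<A> by (rule alg)
    have "F \<in> \<A>" unfolding F_def using A B G by blast
    have EG: "p E (E - G) < d" using le[of "E - G"] G by linarith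
    \<comment> \<open>The choice of \<open>G\<close> leaves \<open>q (G - E)\<close> uncontrolled,
      but \<open>p E\<close> only sees the increase of \<open>q\<close> from \<open>E\<close> to
      \<open>G \<union> E\<close>.\<close>
    have GE: "p E (G - E) < 2 * d"
    proof -
      have "q ((G - E) \<union> E) \<le> q G + q (E - G)"
        using D(2)[of "(G - E) \<union> E" "G \<union> (E - G)"] D(5)[of G "E - G"] by auto
      moreover have "q ((G - E) \<inter> E) = 0" using D(1) by (simp add: Int_commute)
      ultimately show ?thesis using G by (simp add: p_def)
    qed
    have sub4: "p E (V \<union> W \<union> Y \<union> Z) \<le> p E V + p E W + p E Y + p E Z" for V W Y Z
      using sub[of V W] sub[of "V \<union> W" Y] sub[of "V \<union> W \<union> Y" Z] by linarith
    have "p E (X - F) \<le> p E ((X \<inter> E - A) \<union> (E - G) \<union> (G - E) \<union> (X \<union> E - B))"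
      by (rule mono) (auto simp: F_def)
    also have "\<dots> \<le> p E (X \<inter> E - A) + p E (E - G) + p E (G - E) + p E (X \<union> E - B)" by (rule sub4)
    also have "\<dots> < e"
      using le[of "X \<inter> E - A"] le[of "X \<union> E - B"] A B EG GE d unfolding d_def by linarith
    finally have 1: "p E (X - F) < e" .
    \<comment> \<open>With \<open>E\<close> in place of \<open>G\<close> the glued set meets
      \<open>E\<close> in \<open>A \<inter> E\<close> and joins it to \<open>B \<union> E\<close>,
      so its value is explicit. Passing back to \<open>F\<close> costs only
      \<open>p E (E - G)\<close> and \<open>p E (G - E)\<close>.\<close>
    have core: "p E ((A \<inter> E) \<union> (B - E)) \<le> p E X + 3 * d"
    proof -
      have "((A \<inter> E) \<union> (B - E)) \<inter> E = A \<inter> E" "((A \<inter> E) \<union> (B - E)) \<union> E = B \<union> E" by auto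
      then have "p E ((A \<inter> E) \<union> (B - E)) = q (A \<inter> E) + q (B \<union> E) - q E" by (simp add: p_def)
      moreover have "q (A \<inter> E) \<le> q A" by (rule D(2)) auto
      moreover have "q (B \<union> E) \<le> q B + q (X \<union> E - B)"
        using D(2)[of "B \<union> E" "B \<union> (X \<union> E - B)"] D(5)[of B "X \<union> E - B"] by force
      ultimately show ?thesis using A B by (simp add: p_def)
    qed
    have "p E F \<le> p E (((A \<inter> E) \<union> (B - E)) \<union> (E - G) \<union> (G - E) \<union> {})"
      by (rule mono) (auto simp: F_def)
    also have "\<dots> \<le> p E ((A \<inter> E) \<union> (B - E)) + p E (E - G) + p E (G - E) + p E {}" by (rule sub4)
    also have "\<dots> < p E X + e" using core EG GE emp d unfolding d_def by linarith
    finally show ?thesis using 1 \<open>F \<in> \<A>\<close> by blast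
  qed
  show ?thesis unfolding regular_submodular_def using emp mono submod reg by (auto intro: monoI)
qed

text \<open>Zorn's lemma gives a minimal element; its modularization at any \<open>Y\<close> lies
  below it, hence equals it, and that equation is the modular law.\<close>

lemma regular_submodular_dominates_modular:
  assumes alg: "algebra UNIV \<A>" and q: "regular_submodular \<A> q"
  obtains p where "regular_submodular \<A> p" "p \<le> q" "p UNIV = q UNIV"
    "\<And>X Y. p (X \<union> Y) + p (X \<inter> Y) = p X + p Y"
proof -
  \<comment> \<open>The mass condition keeps the descent from losing mass. Modularization respects
    it, since at \<open>UNIV\<close> the two terms \<open>q E\<close> cancel.\<close>
  define K where "K = {p. regular_submodular \<A> p \<and> p \<le> q \<and> p UNIV = q UNIV}"
  have "\<exists>m\<in>K. \<forall>a\<in>K. a \<le> m \<longrightarrow> a = m"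
  proof (rule predicate_Zorn)
    \<comment> \<open>The order is reversed, so that a maximal element is a minimal
      function.\<close>
    show "partial_order_on K (relation_of (\<lambda>x y. y \<le> x) K)"
      by (rule partial_order_on_relation_ofI) auto
  next
    fix C assume "C \<in> Chains (relation_of (\<lambda>x y. y \<le> x) K)"
    then have CK: "C \<subseteq> K" and chain: "\<And>q r. q \<in> C \<Longrightarrow> r \<in> C \<Longrightarrow> q \<le> r \<or> r \<le> q"
      unfolding Chains_def relation_of_def by blast+
    show "\<exists>u\<in>K. \<forall>a\<in>C. u \<le> a"
    proof (cases "C = {}")
      case True
      then show ?thesis using q by (auto simp: K_def)
    next
      case False
      define p where "p = (\<lambda>X. INF q\<in>C. q X)"
      have rs: "regular_submodular \<A> r" if "r \<in> C" for r using that CK by (auto simp: K_def)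
      have bdd: "bdd_below ((\<lambda>q. q X) ` C)" for X
        by (rule bdd_belowI2[of _ 0]) (rule regular_submodularD(4)[OF rs])
      have low: "p \<le> r" if "r \<in> C" for r
        unfolding p_def by (intro le_funI cINF_lower[OF bdd that])
      have "p UNIV = q UNIV"
      proof -
        have "r UNIV = q UNIV" if "r \<in> C" for r using that CK by (auto simp: K_def)
        then have "(\<lambda>r. r UNIV) ` C = {q UNIV}" using False by force
        then show ?thesis by (simp add: p_def)
      qed
      moreover have "regular_submodular \<A> p"
        unfolding p_def by (rule regular_submodular_chain_INF[OF False rs chain])
      moreover have "p \<le> q"
      proof -
        obtain r where r: "r \<in> C" using False by blast
        then have "r \<le> q" using CK by (auto simp: K_def)
        with low[OF r] show ?thesis by (rule order_trans)
      qed
      ultimately have "p \<in> K" by (simp add: K_def)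
      then show ?thesis using low by blast
    qed
  qed
  then obtain p where p: "p \<in> K" and min: "\<And>a. a \<in> K \<Longrightarrow> a \<le> p \<Longrightarrow> a = p" by blast
  then have rp: "regular_submodular \<A> p" by (simp add: K_def)
  have "p (X \<union> Y) + p (X \<inter> Y) = p X + p Y" for X Y
  proof -
    define r where "r = (\<lambda>X. p (X \<inter> Y) + p (X \<union> Y) - p Y)"
    have "r \<le> p" unfolding r_def le_fun_def
      using regular_submodularD(3)[OF rp, of _ Y] by (simp add: algebra_simps)
    moreover have "r \<in> K"
      using regular_submodular_modularize[OF rp alg, of Y] \<open>r \<le> p\<close> p
      by (auto simp: K_def r_def[symmetric] intro: order_trans) (simp add: r_def)
    ultimately have "r = p" by (rule min[rotated])
    then show ?thesis by (metis (no_types) add.commute diff_add_cancel r_def)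
  qed
  then show ?thesis using that[OF rp] p by (simp add: K_def)
qed

subsection \<open>Cylinders and the uniform charge\<close>

text \<open>Indexing by the set of coordinates that carry a 1 lists each cylinder of level
  \<open>t\<close> exactly once as \<open>A\<close> runs through \<open>Pow {..<t}\<close>, so sums
  over cylinders are finite sums.\<close>

definition cell :: "nat \<Rightarrow> nat set \<Rightarrow> path set" where
  "cell t A = cyl (\<lambda>i. i \<in> A) t"

text \<open>By compactness of Cantor space, its open and closed subsets are those decided by
  finitely many coordinates.\<close>

definition clopens :: "path set set" where
  "clopens = {X. \<exists>t. \<forall>\<omega> \<omega>'. (\<forall>i<t. \<omega> i = \<omega>' i) \<longrightarrow> \<omega> \<in> X \<longleftrightarrow> \<omega>' \<in> X}"

lemma mem_cell_iff: "A \<subseteq> {..<t} \<Longrightarrow> \<omega> \<in> cell t A \<longleftrightarrow> {i. i < t \<and> \<omega> i} = A"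
  by (auto simp: cell_def cyl_def)

lemma cyl_eq_cell: "cyl \<omega> t = cell t {i. i < t \<and> \<omega> i}"
  by (auto simp: cell_def cyl_def)

lemma cyl_cong: "\<omega>' \<in> cyl \<omega> t \<Longrightarrow> cyl \<omega>' t = cyl \<omega> t"
  by (auto simp: cyl_def)

lemma algebra_clopens: "algebra UNIV clopens"
proof -
  have "X \<union> Y \<in> clopens" if X: "X \<in> clopens" and Y: "Y \<in> clopens" for X Y
  proof -
    obtain s where s: "\<forall>\<omega> \<omega>'. (\<forall>i<s. \<omega> i = \<omega>' i) \<longrightarrow> \<omega> \<in> X \<longleftrightarrow> \<omega>' \<in> X"
      using X unfolding clopens_def by blast
    obtain t where t: "\<forall>\<omega> \<omega>'. (\<forall>i<t. \<omega> i = \<omega>' i) \<longrightarrow> \<omega> \<in> Y \<longleftrightarrow> \<omega>' \<in> Y"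
      using Y unfolding clopens_def by blast
    show ?thesis
      unfolding clopens_def
    proof (intro CollectI exI[of _ "max s t"] allI impI)
      fix \<omega> \<omega>' :: path assume "\<forall>i<max s t. \<omega> i = \<omega>' i"
      then show "\<omega> \<in> X \<union> Y \<longleftrightarrow> \<omega>' \<in> X \<union> Y"
        using s[rule_format, of \<omega> \<omega>'] t[rule_format, of \<omega> \<omega>'] by simp
    qed
  qed
  moreover have "UNIV - X \<in> clopens" if "X \<in> clopens" for X
    using that unfolding clopens_def by simp
  moreover have "{} \<in> clopens" by (simp add: clopens_def)
  ultimately show ?thesis by (simp add: algebra_iff_Un)
qed

lemma clopen_saturated_level:
  assumes "F \<in> clopens"
  obtains s where "\<And>t A. s \<le> t \<Longrightarrow> A \<subseteq> {..<t} \<Longrightarrow> cell t A \<subseteq> F \<or> cell t A \<inter> F = {}"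
proof -
  obtain s where s: "\<And>\<omega> \<omega>'. (\<forall>i<s. \<omega> i = \<omega>' i) \<Longrightarrow> \<omega> \<in> F \<longleftrightarrow> \<omega>' \<in> F"
    using assms unfolding clopens_def by blast
  have "cell t A \<subseteq> F \<or> cell t A \<inter> F = {}" if "s \<le> t" for t A
  proof -
    have "\<omega> \<in> F \<longleftrightarrow> \<omega>' \<in> F" if "\<omega> \<in> cell t A" "\<omega>' \<in> cell t A" for \<omega> \<omega>'
      using that \<open>s \<le> t\<close> by (intro s) (auto simp: cell_def cyl_def)
    then show ?thesis by blast
  qed
  then show ?thesis using that by blast
qed

lemma Union_cells_clopen: "\<Union> (cell t ` B) \<in> clopens"
  unfolding clopens_def by (intro CollectI exI[of _ t]) (auto simp: cell_def cyl_def)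

lemma clopen_in_sigma:
  assumes S: "admissible_sigma S" and F: "F \<in> clopens"
  shows "F \<in> S"
proof -
  interpret sigma_algebra UNIV S using S by (simp add: admissible_sigma_def)
  obtain t where t: "\<And>A. A \<subseteq> {..<t} \<Longrightarrow> cell t A \<subseteq> F \<or> cell t A \<inter> F = {}"
    by (rule clopen_saturated_level[OF F]) blast
  have "F = \<Union> (cell t ` {A \<in> Pow {..<t}. cell t A \<subseteq> F})" (is "_ = ?R")
  proof
    show "F \<subseteq> ?R"
    proof
      fix \<omega> assume "\<omega> \<in> F"
      moreover have "\<omega> \<in> cell t {i. i < t \<and> \<omega> i}" by (subst mem_cell_iff) auto
      moreover have "{i. i < t \<and> \<omega> i} \<subseteq> {..<t}" by auto
      ultimately show "\<omega> \<in> ?R" using t by blast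
    qed
  qed auto
  moreover have "?R \<in> S"
    using S by (intro finite_Union) (auto simp: admissible_sigma_def cell_def)
  ultimately show ?thesis by simp
qed

text \<open>\<open>A\<close> and \<open>insert t A\<close> index the two halves of
  \<open>cell t A\<close>. The general \<open>g\<close> covers both cell counts and
  affinities.\<close>

lemma sum_cells_Suc:
  fixes g :: "path set \<Rightarrow> 'a::comm_monoid_add"
  shows "(\<Sum>A\<in>Pow {..<Suc t}. g (cell (Suc t) A)) =
    (\<Sum>A\<in>Pow {..<t}. g (cell t A \<inter> {\<omega>. \<omega> t}) + g (cell t A - {\<omega>. \<omega> t}))"
proof -
  have inj: "inj_on (insert t) (Pow {..<t})" by (rule inj_onI) (auto simp: subset_eq set_eq_iff)
  have "cell (Suc t) A = cell t A - {\<omega>. \<omega> t}" "cell (Suc t) (insert t A) = cell t A \<inter> {\<omega>. \<omega> t}"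
    if "A \<subseteq> {..<t}" for A
    using that by (auto simp: cell_def cyl_def less_Suc_eq)
  moreover have "(\<Sum>A\<in>Pow {..<Suc t}. g (cell (Suc t) A)) =
     (\<Sum>A\<in>Pow {..<t}. g (cell (Suc t) A)) + (\<Sum>A\<in>insert t ` Pow {..<t}. g (cell (Suc t) A))"
    unfolding lessThan_Suc Pow_insert by (rule sum.union_disjoint) auto
  ultimately show ?thesis by (simp add: sum.reindex[OF inj] sum.distrib add.commute)
qed

section \<open>Counting cylinders modulo the ideal\<close>

definition cell_frac :: "path set set \<Rightarrow> nat \<Rightarrow> path set \<Rightarrow> real" where
  "cell_frac I t X = (\<Sum>A\<in>Pow {..<t}. of_bool (X \<inter> cell t A \<notin> I)) / 2 ^ t"

text \<open>A cell with trace in the ideal has no counted half, and any other cell at most two,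
  while the denominator doubles.\<close>

lemma cell_frac_antimono_level:
  assumes I: "strictly_proper_ideal I"
  shows "cell_frac I (Suc t) X \<le> cell_frac I t X"
proof -
  define g where "g = (\<lambda>C. of_bool (X \<inter> C \<notin> I) :: real)"
  have mono: "g D \<le> g C" if "D \<subseteq> C" for C D
    using I that unfolding strictly_proper_ideal_def g_def
    by (cases "X \<inter> C \<in> I") (auto, meson Int_mono order_refl)
  have "(\<Sum>A\<in>Pow {..<Suc t}. g (cell (Suc t) A)) \<le> (\<Sum>A\<in>Pow {..<t}. 2 * g (cell t A))"
    unfolding sum_cells_Suc
  proof (rule sum_mono)
    fix A
    show "g (cell t A \<inter> {\<omega>. \<omega> t}) + g (cell t A - {\<omega>. \<omega> t}) \<le> 2 * g (cell t A)"
      using mono[of "cell t A \<inter> {\<omega>. \<omega> t}" "cell t A"] mono[of "cell t A - {\<omega>. \<omega> t}" "cell t A"]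
      by auto
  qed
  then show ?thesis
    by (simp add: cell_frac_def g_def field_simps sum_distrib_left[symmetric])
qed

text \<open>Submodularity holds cell by cell: if the trace of \<open>X \<union> Y\<close> is outside
  the ideal, closure under unions puts the trace of \<open>X\<close> or of \<open>Y\<close> outside;
  if that of \<open>X \<inter> Y\<close> is, closure under subsets puts both outside.\<close>

lemma regular_submodular_cell_frac:
  assumes I: "strictly_proper_ideal I" and emp: "{} \<in> I"
  shows "regular_submodular clopens (cell_frac I t)"
proof -
  let ?g = "\<lambda>X A. of_bool (X \<inter> cell t A \<notin> I) :: real"
  have sub: "R \<in> I" if "R \<subseteq> X" "X \<in> I" for R X
    using I that unfolding strictly_proper_ideal_def by blast
  have un: "R \<union> X \<in> I" if "R \<in> I" "X \<in> I" for R X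
    using I that unfolding strictly_proper_ideal_def by blast
  have "cell_frac I t {} = 0" using emp by (simp add: cell_frac_def)
  moreover have "mono (cell_frac I t)"
  proof (rule monoI)
    fix X Y :: "path set" assume "X \<subseteq> Y"
    then have "?g X A \<le> ?g Y A" for A using sub[of "X \<inter> cell t A" "Y \<inter> cell t A"] by auto
    then show "cell_frac I t X \<le> cell_frac I t Y"
      unfolding cell_frac_def by (intro divide_right_mono sum_mono) auto
  qed
  moreover have "cell_frac I t (X \<union> Y) + cell_frac I t (X \<inter> Y) \<le> cell_frac I t X + cell_frac I t Y" for X Y
  proof -
    have "?g (X \<union> Y) A + ?g (X \<inter> Y) A \<le> ?g X A + ?g Y A" for A
      using un[of "X \<inter> cell t A" "Y \<inter> cell t A"] sub[of "(X \<inter> Y) \<inter> cell t A" "X \<inter> cell t A"]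
        sub[of "(X \<inter> Y) \<inter> cell t A" "Y \<inter> cell t A"]
      by (auto simp: Int_Un_distrib2)
    then show ?thesis
      unfolding cell_frac_def add_divide_distrib[symmetric] sum.distrib[symmetric]
      by (intro divide_right_mono sum_mono) auto
  qed
  moreover have "\<exists>F\<in>clopens. cell_frac I t (X - F) < e \<and> cell_frac I t F < cell_frac I t X + e"
    if "e > 0" for X e
  proof -
    \<comment> \<open>The union of all cells counted for \<open>X\<close> is an exact approximant:
      what remains of \<open>X\<close> lies in the ideal on every cell, and \<open>F\<close> meets
      no uncounted cell.\<close>
    define F where "F = \<Union> (cell t ` {A \<in> Pow {..<t}. X \<inter> cell t A \<notin> I})"
    have "(X - F) \<inter> cell t A \<in> I" if "A \<subseteq> {..<t}" for A
    proof (cases "X \<inter> cell t A \<in> I")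
      case True
      then show ?thesis by (rule sub[rotated]) auto
    next
      case False
      then have "(X - F) \<inter> cell t A = {}" using that by (auto simp: F_def)
      then show ?thesis using emp by simp
    qed
    then have "cell_frac I t (X - F) = 0" by (simp add: cell_frac_def)
    moreover have "?g F A \<le> ?g X A" if "A \<subseteq> {..<t}" for A
    proof (cases "X \<inter> cell t A \<in> I")
      case True
      have "F \<inter> cell t A = {}"
      proof (rule ccontr)
        assume "F \<inter> cell t A \<noteq> {}"
        then obtain \<omega> B where "B \<subseteq> {..<t}" "X \<inter> cell t B \<notin> I" "\<omega> \<in> cell t A" "\<omega> \<in> cell t B"
          unfolding F_def by blast
        then show False using True that mem_cell_iff by metis
      qed
      then show ?thesis using emp by simp
    qed simp
    then have "cell_frac I t F \<le> cell_frac I t X"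
      unfolding cell_frac_def by (intro divide_right_mono sum_mono) auto
    moreover have "F \<in> clopens" unfolding F_def by (rule Union_cells_clopen)
    ultimately show ?thesis using \<open>e > 0\<close> by (intro bexI[of _ F]) auto
  qed
  ultimately show ?thesis unfolding regular_submodular_def by blast
qed

text \<open>Since the ideal contains no cylinder, all \<open>2 ^ t\<close> cells count; this becomes
  the total mass 1 of the charge.\<close>

lemma cell_frac_UNIV:
  assumes "strictly_proper_ideal I"
  shows "cell_frac I t UNIV = 1"
  using assms by (simp add: cell_frac_def strictly_proper_ideal_def cell_def card_Pow)

lemma cell_frac_cyl:
  assumes "{} \<in> I"
  shows "cell_frac I t (cyl \<omega> t) \<le> 1 / 2 ^ t"
proof -
  let ?B = "{i. i < t \<and> \<omega> i}"
  have "(\<Sum>A\<in>Pow {..<t}. of_bool (cyl \<omega> t \<inter> cell t A \<notin> I) :: real) \<le> (\<Sum>A\<in>Pow {..<t}. of_bool (A = ?B))"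
  proof (rule sum_mono)
    fix A assume "A \<in> Pow {..<t}"
    then have "cyl \<omega> t \<inter> cell t A = {}" if "A \<noteq> ?B"
    proof -
      have "A = ?B" if "\<omega>' \<in> cyl \<omega> t" "\<omega>' \<in> cell t A" for \<omega>'
        using that \<open>A \<in> Pow {..<t}\<close> mem_cell_iff[of A t \<omega>'] by (auto simp: cyl_def)
      then show ?thesis using that by blast
    qed
    then show "of_bool (cyl \<omega> t \<inter> cell t A \<notin> I) \<le> (of_bool (A = ?B) :: real)"
      using assms by (cases "A = ?B") simp_all
  qed
  also have "\<dots> = 1"
    unfolding of_bool_def by (subst sum.delta) auto
  finally show ?thesis by (simp add: cell_frac_def divide_right_mono)
qed

text \<open>\<open>P\<close> is an additive function below all levels. Level \<open>t\<close> bounds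
  it on cylinders, level 0 makes it vanish on the ideal, and additivity makes the approximation by
  clopen sets two-sided.\<close>

lemma uniform_charge_null_on_ideal:
  assumes I: "strictly_proper_ideal I"
  obtains P :: "path set \<Rightarrow> real" where
    "\<And>X. 0 \<le> P X" "P UNIV = 1" "\<And>X Y. P (X \<union> Y) + P (X \<inter> Y) = P X + P Y" "P {} = 0"
    "\<And>\<omega> t. P (cyl \<omega> t) \<le> 1 / 2 ^ t" "\<And>X. X \<in> I \<Longrightarrow> P X = 0"
    "\<And>X e. e > 0 \<Longrightarrow> \<exists>F\<in>clopens. P (X - F) < e \<and> P (F - X) < e"
proof -
  \<comment> \<open>A strictly proper ideal may be the empty collection.\<close>
  define J where "J = insert {} I"
  have cyl_ne: "cyl \<omega> t \<noteq> {}" for \<omega> t by (auto simp: cyl_def)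
  have J: "strictly_proper_ideal J"
    using I cyl_ne by (auto simp: J_def strictly_proper_ideal_def)
  have emp: "{} \<in> J" by (simp add: J_def)
  note rs = regular_submodular_cell_frac[OF J emp]
  define C where "C = range (cell_frac J)"
  define q where "q = (\<lambda>X. INF r\<in>C. r X)"
  have "decseq (cell_frac J)"
    by (rule decseq_SucI) (simp add: le_fun_def cell_frac_antimono_level[OF J])
  then have "r \<le> r' \<or> r' \<le> r" if "r \<in> C" "r' \<in> C" for r r'
    using that unfolding C_def decseq_def by (metis imageE linear)
  then have q: "regular_submodular clopens q"
    unfolding q_def by (intro regular_submodular_chain_INF) (auto simp: C_def rs)
  have "bdd_below ((\<lambda>r. r X) ` C)" for X
    by (rule bdd_belowI2[of _ 0]) (auto simp: C_def regular_submodularD(4)[OF rs])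
  then have le: "q X \<le> cell_frac J t X" for X t
    unfolding q_def by (rule cINF_lower) (simp add: C_def)
  have "q UNIV = 1" by (simp add: q_def C_def image_image cell_frac_UNIV[OF J])
  obtain P where P: "regular_submodular clopens P" "P \<le> q" "P UNIV = q UNIV"
    "\<And>X Y. P (X \<union> Y) + P (X \<inter> Y) = P X + P Y"
    by (rule regular_submodular_dominates_modular[OF algebra_clopens q]) blast
  note D = regular_submodularD[OF P(1)]
  have Ple: "P X \<le> cell_frac J t X" for X t
    using le_funD[OF P(2), of X] le[of X t] by linarith
  have approx: "\<exists>F\<in>clopens. P (X - F) < e \<and> P (F - X) < e" if "e > 0" for X e
  proof -
    obtain F where F: "F \<in> clopens" "P (X - F) < e/2" "P F < P X + e/2"
      using D(6)[of "e/2" X] \<open>e > 0\<close> by auto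
    have diff: "P (Y - Z) = P Y - P (Y \<inter> Z)" for Y Z
    proof -
      have "(Y - Z) \<union> (Y \<inter> Z) = Y" "(Y - Z) \<inter> (Y \<inter> Z) = {}" by auto
      then show ?thesis using P(4)[of "Y - Z" "Y \<inter> Z"] D(1) by simp
    qed
    \<comment> \<open>Hence \<open>P (F - X) = (P F - P X) + P (X - F)\<close>, and both summands
      are below \<open>e / 2\<close>.\<close>
    have "P (F - X) = P F - P (F \<inter> X)" "P (X - F) = P X - P (F \<inter> X)"
      using diff[of F X] diff[of X F] by (simp_all add: Int_commute)
    then show ?thesis using F \<open>e > 0\<close> by (intro bexI[of _ F]) auto
  qed
  have null: "P X = 0" if "X \<in> I" for X
  proof -
    have "X \<in> J" using that by (simp add: J_def)
    \<comment> \<open>\<open>cell 0 {}\<close> is the whole space, so level 0 tests a single trace,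
      that of \<open>X\<close> itself.\<close>
    moreover have "X \<inter> cell 0 {} \<subseteq> X" by auto
    ultimately have "X \<inter> cell 0 {} \<in> J" using J unfolding strictly_proper_ideal_def by blast
    then have "P X \<le> 0" using Ple[of X 0] by (simp add: cell_frac_def)
    then show ?thesis using D(4)[of X] by simp
  qed
  have "P (cyl \<omega> t) \<le> 1 / 2 ^ t" for \<omega> t
    using Ple[of "cyl \<omega> t" t] cell_frac_cyl[OF emp, of t \<omega>] by linarith
  then show ?thesis using that[of P] D(1,4) P(3,4) \<open>q UNIV = 1\<close> null approx by auto
qed

subsection \<open>Finitely additive probabilities\<close>

lemma fa_probD:
  assumes "sigma_algebra UNIV S" "fa_prob S P"
  shows "E \<in> S \<Longrightarrow> 0 \<le> P E" "P UNIV = 1" "P {} = 0"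
    and "E \<in> S \<Longrightarrow> F \<in> S \<Longrightarrow> E \<inter> F = {} \<Longrightarrow> P (E \<union> F) = P E + P F"
    and "E \<in> S \<Longrightarrow> F \<in> S \<Longrightarrow> P E = P (E \<inter> F) + P (E - F)"
    and "E \<in> S \<Longrightarrow> F \<in> S \<Longrightarrow> E \<subseteq> F \<Longrightarrow> P E \<le> P F"
    and "E \<in> S \<Longrightarrow> P E \<le> 1"
proof -
  interpret sigma_algebra UNIV S by fact
  show pos: "0 \<le> P E" if "E \<in> S" for E using assms(2) that by (simp add: fa_prob_def)
  show one: "P UNIV = 1" using assms(2) by (simp add: fa_prob_def)
  show add: "P (E \<union> F) = P E + P F" if "E \<in> S" "F \<in> S" "E \<inter> F = {}" for E F
    using assms(2) that by (simp add: fa_prob_def)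
  show "P {} = 0" using add[of "{}" "{}"] by simp
  show split: "P E = P (E \<inter> F) + P (E - F)" if "E \<in> S" "F \<in> S" for E F
  proof -
    have "(E \<inter> F) \<union> (E - F) = E" by auto
    then show ?thesis using add[of "E \<inter> F" "E - F"] that by auto
  qed
  show mono: "P E \<le> P F" if "E \<in> S" "F \<in> S" "E \<subseteq> F" for E F
  proof -
    have "F \<inter> E = E" "F - E \<in> S" using that by auto
    then show ?thesis using split[of F E] pos[of "F - E"] that by simp
  qed
  show "P E \<le> 1" if "E \<in> S" using mono[of E UNIV] that one by auto
qed

lemma fa_prob_finite_Union:
  assumes S: "sigma_algebra UNIV S" and P: "fa_prob S P"
    and "finite B" "disjoint_family_on G B" "\<And>A. A \<in> B \<Longrightarrow> G A \<in> S"
  shows "P (\<Union> (G ` B)) = (\<Sum>A\<in>B. P (G A))"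
  using assms(3-5)
proof (induction B)
  case empty
  then show ?case using fa_probD(3)[OF S P] by simp
next
  case (insert A B)
  interpret sigma_algebra UNIV S by (rule S)
  have "G A \<inter> \<Union> (G ` B) = {}"
    using insert.prems(1) insert.hyps(2) by (auto simp: disjoint_family_on_def)
  moreover have "\<Union> (G ` B) \<in> S" using insert.prems insert.hyps by (intro finite_Union) auto
  moreover have "disjoint_family_on G B"
    using insert.prems(1) by (auto simp: disjoint_family_on_def)
  ultimately show ?case using insert fa_probD(4)[OF S P, of "G A" "\<Union> (G ` B)"] by simp
qed

lemma disjoint_family_on_cell: "disjoint_family_on (cell t) (Pow {..<t})"
  by (auto simp: disjoint_family_on_def mem_cell_iff)

lemma cell_clopen: "cell t A \<in> clopens"
  using Union_cells_clopen[of t "{A}"] by simp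

lemma tendsto_0_of_less_inverse:
  fixes f :: "nat \<Rightarrow> real"
  assumes "\<And>n. 0 \<le> f n" "\<And>n. f n < inverse (real (Suc n))"
  shows "f \<longlonglongrightarrow> 0"
  using assms
  by (intro tendsto_sandwich[OF _ _ tendsto_const LIMSEQ_inverse_real_of_nat] always_eventually allI)
    (auto intro: less_imp_le)

text \<open>Otherwise there are sets with \<open>P\<close>-values below \<open>1 / (n + 1)\<close>
  and \<open>Q\<close>-values at least \<open>e\<close>, a sequence that violates absolute
  continuity.\<close>

lemma abs_cont_eps_delta:
  assumes pos: "\<And>E. E \<in> S \<Longrightarrow> 0 \<le> P E" and ac: "abs_cont S Q P" and e: "e > 0"
  obtains d :: real where "d > 0" "\<And>E. E \<in> S \<Longrightarrow> P E < d \<Longrightarrow> Q E < e"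
proof -
  have "\<exists>d>0. \<forall>E\<in>S. P E < d \<longrightarrow> Q E < e"
  proof (rule ccontr)
    assume "\<not> (\<exists>d>0. \<forall>E\<in>S. P E < d \<longrightarrow> Q E < e)"
    then have "\<exists>E\<in>S. P E < inverse (real (Suc n)) \<and> Q E \<ge> e" for n
      by (metis inverse_positive_iff_positive not_le of_nat_0_less_iff zero_less_Suc)
    then obtain E where E: "\<And>n. E n \<in> S" "\<And>n. P (E n) < inverse (real (Suc n))" "\<And>n. Q (E n) \<ge> e"
      by metis
    have "(\<lambda>n. P (E n)) \<longlonglongrightarrow> 0"
      by (rule tendsto_0_of_less_inverse) (use pos E in auto)
    then have "(\<lambda>n. Q (E n)) \<longlonglongrightarrow> 0" using ac E(1) by (simp add: abs_cont_def)
    then have "e \<le> 0" by (rule LIMSEQ_le_const) (use E(3) in auto)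
    then show False using e by simp
  qed
  then show ?thesis using that by blast
qed

subsection \<open>Hellinger affinity and merging\<close>

text \<open>Cauchy-Schwarz for \<open>(sqrt a, sqrt b)\<close> and \<open>(sqrt c, sqrt d)\<close>;
  it is the reason that affinity decreases under splitting.\<close>

lemma sqrt_mult_superadditive:
  fixes a b c d :: real
  assumes "0 \<le> a" "0 \<le> b" "0 \<le> c" "0 \<le> d"
  shows "sqrt (a * c) + sqrt (b * d) \<le> sqrt ((a + b) * (c + d))"
proof (rule real_le_rsqrt)
  have "2 * (sqrt (a * d) * sqrt (b * c)) \<le> (sqrt (a * d))\<^sup>2 + (sqrt (b * c))\<^sup>2"
    using sum_squares_bound[of "sqrt (a * d)" "sqrt (b * c)"] by simp
  moreover have "sqrt (a * d) * sqrt (b * c) = sqrt (a * c) * sqrt (b * d)"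
    by (simp add: real_sqrt_mult mult_ac)
  ultimately show "(sqrt (a * c) + sqrt (b * d))\<^sup>2 \<le> (a + b) * (c + d)"
    using assms by (simp add: power2_sum algebra_simps)
qed

text \<open>The affinity of two two-point distributions is 1 minus half the sum of the squared
  differences of the roots. Roots are at most 1, so a difference of roots is at least half the
  difference of their squares, and each squared difference of roots is at least
  \<open>(p - q)\<^sup>2 / 4\<close>.\<close>

lemma bhattacharyya_le:
  fixes p q :: real
  assumes "0 \<le> p" "p \<le> 1" "0 \<le> q" "q \<le> 1"
  shows "sqrt (p * q) + sqrt ((1 - p) * (1 - q)) \<le> 1 - (p - q)\<^sup>2 / 4"
proof -
  define x y u v where "x = sqrt p" "y = sqrt q" "u = sqrt (1 - p)" "v = sqrt (1 - q)"
  note xyuv = this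
  have sq: "p = x\<^sup>2" "q = y\<^sup>2" "1 - p = u\<^sup>2" "1 - q = v\<^sup>2" and
    rng: "0 \<le> x" "x \<le> 1" "0 \<le> y" "y \<le> 1" "0 \<le> u" "u \<le> 1" "0 \<le> v" "v \<le> 1"
    using assms by (auto simp: xyuv)
  have diff: "(s\<^sup>2 - r\<^sup>2)\<^sup>2 \<le> 4 * (s - r)\<^sup>2" if "0 \<le> s" "s \<le> 1" "0 \<le> r" "r \<le> 1" for s r :: real
  proof -
    have "(s + r)\<^sup>2 \<le> 2\<^sup>2" by (rule power_mono) (use that in auto)
    then have "(s + r)\<^sup>2 * (s - r)\<^sup>2 \<le> 4 * (s - r)\<^sup>2" by (intro mult_right_mono) auto
    moreover have "(s\<^sup>2 - r\<^sup>2) = (s + r) * (s - r)" by (simp add: power2_eq_square algebra_simps)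
    ultimately show ?thesis by (simp add: power_mult_distrib)
  qed
  have "(p - q)\<^sup>2 \<le> 4 * (x - y)\<^sup>2" using diff[of x y] rng sq by simp
  moreover have "(p - q)\<^sup>2 \<le> 4 * (u - v)\<^sup>2"
    using diff[of u v] rng by (simp flip: sq add: power2_commute)
  moreover have "x * y + u * v = 1 - ((x - y)\<^sup>2 + (u - v)\<^sup>2) / 2"
  proof -
    have "x\<^sup>2 + u\<^sup>2 = 1" "y\<^sup>2 + v\<^sup>2 = 1" using sq by auto
    then show ?thesis by (simp add: power2_diff field_simps)
  qed
  ultimately show ?thesis by (simp add: xyuv real_sqrt_mult)
qed

text \<open>\<open>a\<close>, \<open>b\<close> and \<open>c\<close>, \<open>d\<close> are the masses
  of the two pieces of a cell under two charges; dividing by the cell masses reduces to two-point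
  distributions.\<close>

lemma sqrt_mult_split_gap:
  fixes a b c d e :: real
  assumes nn: "0 \<le> a" "0 \<le> b" "0 \<le> c" "0 \<le> d" and pos: "0 < a + b" "0 < c + d" and "0 \<le> e"
    and gap: "\<bar>a / (a + b) - c / (c + d)\<bar> \<ge> e"
  shows "sqrt (a * c) + sqrt (b * d) \<le> (1 - e\<^sup>2 / 4) * sqrt ((a + b) * (c + d))"
proof -
  define p q where "p = a / (a + b)" and "q = c / (c + d)"
  have eqs: "a = p * (a + b)" "b = (1 - p) * (a + b)" "c = q * (c + d)" "d = (1 - q) * (c + d)"
    using pos by (auto simp: p_def q_def field_simps)
  have "sqrt (a * c) = sqrt (p * q) * sqrt ((a + b) * (c + d))"
    by (subst eqs(1), subst eqs(3)) (simp add: real_sqrt_mult mult_ac)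
  moreover have "sqrt (b * d) = sqrt ((1 - p) * (1 - q)) * sqrt ((a + b) * (c + d))"
    by (subst eqs(2), subst eqs(4)) (simp add: real_sqrt_mult mult_ac)
  moreover have "sqrt (p * q) + sqrt ((1 - p) * (1 - q)) \<le> 1 - e\<^sup>2 / 4"
  proof -
    have "e\<^sup>2 \<le> (p - q)\<^sup>2"
      using gap \<open>0 \<le> e\<close> by (intro abs_le_square_iff[THEN iffD1]) (simp add: p_def q_def)
    moreover have "sqrt (p * q) + sqrt ((1 - p) * (1 - q)) \<le> 1 - (p - q)\<^sup>2 / 4"
      using nn pos by (intro bhattacharyya_le) (auto simp: p_def q_def)
    ultimately show ?thesis by linarith
  qed
  ultimately show ?thesis
    using mult_right_mono[of "sqrt (p * q) + sqrt ((1 - p) * (1 - q))" "1 - e\<^sup>2 / 4" "sqrt ((a + b) * (c + d))"]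
      nn by (simp add: distrib_right)
qed

section \<open>Affinity along the cylinder levels\<close>

definition hellinger_level ::
  "(path set \<Rightarrow> real) \<Rightarrow> (path set \<Rightarrow> real) \<Rightarrow> nat \<Rightarrow> path set \<Rightarrow> real" where
  "hellinger_level P Q t X = (\<Sum>A\<in>Pow {..<t}. sqrt (P (X \<inter> cell t A) * Q (X \<inter> cell t A)))"

lemma sqrt_charges_split:
  assumes S: "sigma_algebra UNIV S" and P: "fa_prob S P" and Q: "fa_prob S Q" and XY: "X \<in> S" "Y \<in> S"
  shows "sqrt (P (X \<inter> Y) * Q (X \<inter> Y)) + sqrt (P (X - Y) * Q (X - Y)) \<le> sqrt (P X * Q X)"
proof -
  interpret sigma_algebra UNIV S by (rule S)
  have "X \<inter> Y \<in> S" "X - Y \<in> S" using XY by auto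
  then show ?thesis
    using sqrt_mult_superadditive[of "P (X \<inter> Y)" "P (X - Y)" "Q (X \<inter> Y)" "Q (X - Y)"]
      fa_probD(1)[OF S P] fa_probD(1)[OF S Q] fa_probD(5)[OF S P XY] fa_probD(5)[OF S Q XY]
    by simp
qed

lemma hellinger_level_antimono:
  assumes adm: "admissible_sigma S" and P: "fa_prob S P" and Q: "fa_prob S Q" and X: "X \<in> S"
    and "t \<le> s"
  shows "hellinger_level P Q s X \<le> hellinger_level P Q t X"
proof -
  have S: "sigma_algebra UNIV S" using adm by (simp add: admissible_sigma_def)
  interpret sigma_algebra UNIV S by (rule S)
  have "hellinger_level P Q (Suc t) X \<le> hellinger_level P Q t X" for t
    unfolding hellinger_level_def sum_cells_Suc[of "\<lambda>C. sqrt (P (X \<inter> C) * Q (X \<inter> C))"]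
  proof (rule sum_mono)
    fix A
    have "{\<omega>. \<omega> t} \<in> clopens" by (auto simp: clopens_def)
    then show "sqrt (P (X \<inter> (cell t A \<inter> {\<omega>. \<omega> t})) * Q (X \<inter> (cell t A \<inter> {\<omega>. \<omega> t}))) +
        sqrt (P (X \<inter> (cell t A - {\<omega>. \<omega> t})) * Q (X \<inter> (cell t A - {\<omega>. \<omega> t})))
      \<le> sqrt (P (X \<inter> cell t A) * Q (X \<inter> cell t A))"
      using sqrt_charges_split[OF S P Q, of "X \<inter> cell t A" "{\<omega>. \<omega> t}"] X
        clopen_in_sigma[OF adm] cell_clopen by (auto simp: Int_Diff Int_assoc)
  qed
  then show ?thesis using \<open>t \<le> s\<close> by (rule lift_Suc_antimono_le)
qed

text \<open>For clopen \<open>E\<close>, each cell of a fine level lies in \<open>E\<close> or in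
  its complement, so splitting by \<open>E\<close> is free there, and returning to level
  \<open>t\<close> can only increase the sum. General \<open>E\<close> follows by approximation, the
  right side being a finite sum continuous in the masses.\<close>

lemma hellinger_split_ge:
  assumes adm: "admissible_sigma S" and P: "fa_prob S P" and Q: "fa_prob S Q"
    and dense: "\<And>E e. E \<in> S \<Longrightarrow> e > 0 \<Longrightarrow> \<exists>F\<in>clopens. P (E - F) < e \<and> P (F - E) < e"
    and ac: "abs_cont S Q P" and L: "\<And>s. L \<le> hellinger_level P Q s UNIV" and E: "E \<in> S"
  shows "L \<le> hellinger_level P Q t E + hellinger_level P Q t (- E)"
proof -
  have S: "sigma_algebra UNIV S" using adm by (simp add: admissible_sigma_def)
  interpret sigma_algebra UNIV S by (rule S)
  note clS = clopen_in_sigma[OF adm]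
  have clopen_case: "L \<le> hellinger_level P Q t F + hellinger_level P Q t (- F)" if F: "F \<in> clopens" for F
  proof -
    obtain s0 where s0: "\<And>s A. s0 \<le> s \<Longrightarrow> A \<subseteq> {..<s} \<Longrightarrow> cell s A \<subseteq> F \<or> cell s A \<inter> F = {}"
      by (rule clopen_saturated_level[OF F]) blast
    define s where "s = max s0 t"
    let ?h = "\<lambda>X. sqrt (P X * Q X)"
    have "?h (F \<inter> cell s A) + ?h (- F \<inter> cell s A) = ?h (UNIV \<inter> cell s A)" if "A \<subseteq> {..<s}" for A
    proof -
      have "F \<inter> cell s A = cell s A \<and> - F \<inter> cell s A = {} \<or> F \<inter> cell s A = {} \<and> - F \<inter> cell s A = cell s A"
        using s0[of s A] that by (auto simp: s_def)
      then show ?thesis using fa_probD(3)[OF S P] by auto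
    qed
    then have "hellinger_level P Q s F + hellinger_level P Q s (- F) = hellinger_level P Q s UNIV"
      unfolding hellinger_level_def sum.distrib[symmetric] by (intro sum.cong) auto
    moreover have "- F \<in> S" using clS[OF F] by (metis Compl_eq_Diff_UNIV compl_sets)
    ultimately show ?thesis
      using L[of s] hellinger_level_antimono[OF adm P Q, of F t s]
        hellinger_level_antimono[OF adm P Q, of "- F" t s] clS[OF F] by (simp add: s_def)
  qed
  obtain F where F: "\<And>n. F n \<in> clopens" "\<And>n. P (E - F n) < inverse (real (Suc n))"
    "\<And>n. P (F n - E) < inverse (real (Suc n))"
    using dense[OF E, of "inverse (real (Suc _))"] by (metis inverse_positive_iff_positive of_nat_0_less_iff zero_less_Suc)
  have inS: "E - F n \<in> S" "F n - E \<in> S" for n using E clS[OF F(1)] by auto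
  have P0: "(\<lambda>n. P (G n)) \<longlonglongrightarrow> 0" if "\<And>n. G n \<in> S" "\<And>n. P (G n) < inverse (real (Suc n))" for G
    by (rule tendsto_0_of_less_inverse) (use fa_probD(1)[OF S P] that in auto)
  \<comment> \<open>Absolute continuity makes the \<open>F n\<close> approximate \<open>E\<close>
    for \<open>Q\<close> as well as for \<open>P\<close>.\<close>
  have Q0: "(\<lambda>n. Q (G n)) \<longlonglongrightarrow> 0" if "\<And>n. G n \<in> S" "\<And>n. P (G n) < inverse (real (Suc n))" for G
    using ac P0[OF that] that(1) by (simp add: abs_cont_def)
  \<comment> \<open>The masses of two traces on \<open>C\<close> differ by at most the mass of the
    symmetric difference. The general \<open>R\<close> covers \<open>P\<close> and
    \<open>Q\<close>.\<close>
  have conv: "(\<lambda>n. R (F n \<inter> C)) \<longlonglongrightarrow> R (E \<inter> C)" "(\<lambda>n. R (- F n \<inter> C)) \<longlonglongrightarrow> R (- E \<inter> C)"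
    if R: "fa_prob S R" and R0: "(\<lambda>n. R (E - F n)) \<longlonglongrightarrow> 0" "(\<lambda>n. R (F n - E)) \<longlonglongrightarrow> 0" and C: "C \<in> S" for R C
  proof -
    have lim: "(\<lambda>n. R (E - F n) + R (F n - E)) \<longlonglongrightarrow> 0" using tendsto_add[OF R0] by simp
    have bd: "\<bar>R (X \<inter> C) - R (Y \<inter> C)\<bar> \<le> R (X - Y) + R (Y - X)" if XY: "X \<in> S" "Y \<in> S" for X Y
    proof -
      have "R (X \<inter> C) = R (X \<inter> C \<inter> Y) + R (X \<inter> C - Y)" "R (Y \<inter> C) = R (Y \<inter> C \<inter> X) + R (Y \<inter> C - X)"
        using XY C by (auto intro!: fa_probD(5)[OF S R])
      moreover have "R (X \<inter> C - Y) \<le> R (X - Y)" "R (Y \<inter> C - X) \<le> R (Y - X)"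
        using XY C by (auto intro!: fa_probD(6)[OF S R])
      moreover have "0 \<le> R (X \<inter> C - Y)" "0 \<le> R (Y \<inter> C - X)"
        using XY C by (auto intro!: fa_probD(1)[OF S R])
      moreover have "R (X \<inter> C \<inter> Y) = R (Y \<inter> C \<inter> X)" by (simp add: Int_ac)
      ultimately show ?thesis by linarith
    qed
    show "(\<lambda>n. R (F n \<inter> C)) \<longlonglongrightarrow> R (E \<inter> C)"
    proof (rule LIM_zero_cancel, rule Lim_null_comparison[OF _ lim], rule always_eventually, rule allI)
      fix n show "norm (R (F n \<inter> C) - R (E \<inter> C)) \<le> R (E - F n) + R (F n - E)"
        using bd[OF clS[OF F(1)[of n]] E] by simp
    qed
    have compl: "- X \<in> S" if "X \<in> S" for X using that by (metis Compl_eq_Diff_UNIV compl_sets)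
    show "(\<lambda>n. R (- F n \<inter> C)) \<longlonglongrightarrow> R (- E \<inter> C)"
    proof (rule LIM_zero_cancel, rule Lim_null_comparison[OF _ lim], rule always_eventually, rule allI)
      fix n
      have "- F n - - E = E - F n" "- E - - F n = F n - E" by auto
      then show "norm (R (- F n \<inter> C) - R (- E \<inter> C)) \<le> R (E - F n) + R (F n - E)"
        using bd[OF compl[OF clS[OF F(1)[of n]]] compl[OF E]] by simp
    qed
  qed
  have cS: "cell t A \<in> S" for A by (rule clS[OF cell_clopen])
  note cP = conv[OF P P0 P0, OF inS(1) F(2) inS(2) F(3) cS]
  note cQ = conv[OF Q Q0 Q0, OF inS(1) F(2) inS(2) F(3) cS]
  have "(\<lambda>n. hellinger_level P Q t (F n) + hellinger_level P Q t (- F n))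
      \<longlonglongrightarrow> hellinger_level P Q t E + hellinger_level P Q t (- E)"
    unfolding hellinger_level_def
    by (intro tendsto_add tendsto_sum tendsto_real_sqrt tendsto_mult cP cQ)
  then show ?thesis by (rule LIMSEQ_le_const) (use clopen_case[OF F(1)] in auto)
qed

section \<open>Merging from the loss of affinity\<close>

lemma bad_set_cong: "cyl \<omega> t = cyl \<omega>' t \<Longrightarrow> \<omega> \<in> bad_set S P Q \<epsilon> t \<longleftrightarrow> \<omega>' \<in> bad_set S P Q \<epsilon> t"
  unfolding bad_set_def cond_prob_def by simp

text \<open>Being bad depends only on the cylinder of level \<open>t\<close>, so one representative
  path per cell decides; in particular the bad set is clopen and lies in the sigma-algebra.\<close>

lemma bad_set_eq_Union_cells:
  "bad_set S P Q \<epsilon> t = \<Union> (cell t ` {A \<in> Pow {..<t}. (\<lambda>i. i \<in> A) \<in> bad_set S P Q \<epsilon> t})"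
  (is "_ = \<Union> (cell t ` ?B)")
proof (intro subset_antisym subsetI)
  fix \<omega> assume \<omega>: "\<omega> \<in> bad_set S P Q \<epsilon> t"
  let ?A = "{i. i < t \<and> \<omega> i}"
  have "?A \<in> ?B"
    using \<omega> bad_set_cong[of \<omega> t "\<lambda>i. i \<in> ?A"] cyl_eq_cell[of \<omega> t] by (auto simp: cell_def)
  moreover have "\<omega> \<in> cell t ?A" by (auto simp: cell_def cyl_def)
  ultimately show "\<omega> \<in> \<Union> (cell t ` ?B)" by blast
next
  fix \<omega> assume "\<omega> \<in> \<Union> (cell t ` ?B)"
  then obtain A where A: "A \<in> ?B" "\<omega> \<in> cell t A" by blast
  then show "\<omega> \<in> bad_set S P Q \<epsilon> t"
    using bad_set_cong[OF cyl_cong[of \<omega> "\<lambda>i. i \<in> A" t]] by (auto simp: cell_def)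
qed

text \<open>Witnesses of the gap on the separate bad cells are merged into one set \<open>E\<close>.
  Splitting by \<open>E\<close> loses the proportion \<open>\<epsilon>\<^sup>2 / 4\<close> of the
  affinity of every bad cell, yet cannot bring the total below \<open>L\<close>.\<close>

lemma bad_cells_hellinger_bound:
  assumes adm: "admissible_sigma S" and P: "fa_prob S P" and Q: "fa_prob S Q"
    and dense: "\<And>E e. E \<in> S \<Longrightarrow> e > 0 \<Longrightarrow> \<exists>F\<in>clopens. P (E - F) < e \<and> P (F - E) < e"
    and ac: "abs_cont S Q P" and L: "\<And>s. L \<le> hellinger_level P Q s UNIV" and e: "\<epsilon> > 0"
    and B: "B = {A \<in> Pow {..<t}. (\<lambda>i. i \<in> A) \<in> bad_set S P Q \<epsilon> t}"
  shows "(\<Sum>A\<in>B. sqrt (P (cell t A) * Q (cell t A))) * (\<epsilon>\<^sup>2 / 4) \<le> hellinger_level P Q t UNIV - L"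
proof -
  have S: "sigma_algebra UNIV S" using adm by (simp add: admissible_sigma_def)
  interpret sigma_algebra UNIV S by (rule S)
  have cS: "cell t A \<in> S" for A by (rule clopen_in_sigma[OF adm cell_clopen])
  \<comment> \<open>A constant sequence shows that \<open>P\<close>-null sets are
    \<open>Q\<close>-null, which excludes the first alternative of \<open>bad_set\<close>.\<close>
  have zero: "Q E = 0" if "E \<in> S" "P E = 0" for E
  proof -
    have "(\<lambda>_::nat. Q E) \<longlonglongrightarrow> 0" using ac that unfolding abs_cont_def by auto
    then show ?thesis by (simp add: LIMSEQ_const_iff)
  qed
  have "\<exists>E\<in>S. \<epsilon> < \<bar>P (E \<inter> cell t A) / P (cell t A) - Q (E \<inter> cell t A) / Q (cell t A)\<bar>"
    and posA: "P (cell t A) > 0 \<and> Q (cell t A) > 0" if "A \<in> B" for A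
  proof -
    have bad: "Q (cell t A) > 0 \<and> P (cell t A) > 0 \<and>
       (SUP E\<in>S. \<bar>P (E \<inter> cell t A) / P (cell t A) - Q (E \<inter> cell t A) / Q (cell t A)\<bar>) > \<epsilon>"
      using that zero[OF cS] unfolding B bad_set_def cond_prob_def cell_def by auto
    then show "P (cell t A) > 0 \<and> Q (cell t A) > 0" by simp
    show "\<exists>E\<in>S. \<epsilon> < \<bar>P (E \<inter> cell t A) / P (cell t A) - Q (E \<inter> cell t A) / Q (cell t A)\<bar>"
    proof (rule ccontr)
      assume "\<not> ?thesis"
      then have "(SUP E\<in>S. \<bar>P (E \<inter> cell t A) / P (cell t A) - Q (E \<inter> cell t A) / Q (cell t A)\<bar>) \<le> \<epsilon>"
        by (intro cSUP_least) (auto simp: not_less)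
      then show False using bad by simp
    qed
  qed
  then obtain G where G: "\<And>A. A \<in> B \<Longrightarrow> G A \<in> S"
    "\<And>A. A \<in> B \<Longrightarrow> \<epsilon> < \<bar>P (G A \<inter> cell t A) / P (cell t A) - Q (G A \<inter> cell t A) / Q (cell t A)\<bar>"
    by metis
  \<comment> \<open>The union is finite, so it stays in \<open>S\<close>; the cells are disjoint, so
    on each bad cell it agrees with that cell's own witness.\<close>
  define E where "E = (\<Union>A\<in>B. G A \<inter> cell t A)"
  have finB: "finite B" by (simp add: B)
  have E: "E \<in> S" unfolding E_def using G(1) cS finB by (intro finite_UN) auto
  have EG: "E \<inter> cell t A = G A \<inter> cell t A" if "A \<in> B" for A
  proof -
    have "cell t A' \<inter> cell t A = {}" if "A' \<in> B" "A' \<noteq> A" for A'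
      using disjoint_family_on_cell[of t] that \<open>A \<in> B\<close> unfolding disjoint_family_on_def B by auto
    then show ?thesis using that by (fastforce simp: E_def)
  qed
  let ?h = "\<lambda>X. sqrt (P X * Q X)"
  \<comment> \<open>Loss on a single cell: the gap estimate on bad cells, mere nonnegativity by
    Cauchy-Schwarz on the others.\<close>
  have "(if A \<in> B then ?h (cell t A) * (\<epsilon>\<^sup>2 / 4) else 0) \<le>
      ?h (UNIV \<inter> cell t A) - (?h (E \<inter> cell t A) + ?h (- E \<inter> cell t A))" for A
  proof -
    have sets: "cell t A \<inter> E = E \<inter> cell t A" "cell t A - E = - E \<inter> cell t A" by auto
    note sP = fa_probD(5)[OF S P cS[of A] E, unfolded sets]
    note sQ = fa_probD(5)[OF S Q cS[of A] E, unfolded sets]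
    have m: "E \<inter> cell t A \<in> S" "- E \<inter> cell t A \<in> S"
      using E cS[of A] sets(2)[symmetric] by auto
    show ?thesis
    proof (cases "A \<in> B")
      case True
      have "?h (E \<inter> cell t A) + ?h (- E \<inter> cell t A) \<le> (1 - \<epsilon>\<^sup>2 / 4) * ?h (cell t A)"
        by (rule sqrt_mult_split_gap[of "P (E \<inter> cell t A)" "P (- E \<inter> cell t A)"
              "Q (E \<inter> cell t A)" "Q (- E \<inter> cell t A)" \<epsilon>, folded sP sQ])
          (use e posA[OF True] G(2)[OF True] m fa_probD(1)[OF S P] fa_probD(1)[OF S Q]
            in \<open>simp_all add: EG[OF True]\<close>)
      then show ?thesis using True by (simp add: algebra_simps)
    next
      case False
      then show ?thesis using sqrt_charges_split[OF S P Q cS[of A] E] by (simp add: sets)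
    qed
  qed
  then have "(\<Sum>A\<in>Pow {..<t}. if A \<in> B then ?h (cell t A) * (\<epsilon>\<^sup>2 / 4) else 0) \<le>
      hellinger_level P Q t UNIV - (hellinger_level P Q t E + hellinger_level P Q t (- E))"
    unfolding hellinger_level_def sum.distrib[symmetric] sum_subtractf[symmetric] by (rule sum_mono)
  also have "\<dots> \<le> hellinger_level P Q t UNIV - L"
    using hellinger_split_ge[OF adm P Q dense ac L E, of t] by simp
  also have "(\<Sum>A\<in>Pow {..<t}. if A \<in> B then ?h (cell t A) * (\<epsilon>\<^sup>2 / 4) else 0)
      = (\<Sum>A\<in>B. ?h (cell t A) * (\<epsilon>\<^sup>2 / 4))"
    by (rule sum.mono_neutral_cong_right) (auto simp: B)
  finally show ?thesis unfolding sum_distrib_right .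
qed

lemma blackwell_dubins_of_clopen_dense:
  assumes adm: "admissible_sigma S" and P: "fa_prob S P"
    and dense: "\<And>E e. E \<in> S \<Longrightarrow> e > 0 \<Longrightarrow> \<exists>F\<in>clopens. P (E - F) < e \<and> P (F - E) < e"
  shows "blackwell_dubins S P"
  unfolding blackwell_dubins_def merges_def
proof (intro allI impI, elim conjE)
  fix Q and \<epsilon> :: real assume Q: "fa_prob S Q" and ac: "abs_cont S Q P" and e: "\<epsilon> > 0"
  have S: "sigma_algebra UNIV S" using adm by (simp add: admissible_sigma_def)
  interpret sigma_algebra UNIV S by (rule S)
  note clS = clopen_in_sigma[OF adm]
  have cS: "cell t A \<in> S" for t A by (rule clS[OF cell_clopen])
  have nn: "0 \<le> P (cell t A)" "0 \<le> Q (cell t A)" for t A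
    using fa_probD(1)[OF S P cS] fa_probD(1)[OF S Q cS] by auto
  have un: "R (\<Union> (cell t ` B)) = (\<Sum>A\<in>B. R (cell t A))" if "fa_prob S R" "B \<subseteq> Pow {..<t}" for R B t
  proof (rule fa_prob_finite_Union[OF S that(1)])
    show "finite B" using that(2) finite_subset by blast
    show "disjoint_family_on (cell t) B"
      using disjoint_family_on_cell that(2) by (rule disjoint_family_on_mono[rotated])
  qed (rule cS)
  define \<Phi> where "\<Phi> = (\<lambda>t. hellinger_level P Q t UNIV)"
  have dec: "decseq \<Phi>"
    unfolding \<Phi>_def by (intro antimonoI hellinger_level_antimono[OF adm P Q]) auto
  have nonneg: "\<forall>t. 0 \<le> \<Phi> t"
    unfolding \<Phi>_def hellinger_level_def by (intro allI sum_nonneg) (simp add: nn)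
  obtain L where "\<Phi> \<longlonglongrightarrow> L" "\<forall>t. L \<le> \<Phi> t"
    by (rule decseq_convergent[OF dec nonneg])
  then have L: "\<Phi> \<longlonglongrightarrow> L" "\<And>t. L \<le> \<Phi> t" by auto
  show "(\<lambda>t. Q (bad_set S P Q \<epsilon> t)) \<longlonglongrightarrow> 0"
  proof (rule LIMSEQ_I)
    fix r :: real assume r: "r > 0"
    obtain d where d: "d > 0" "\<And>E. E \<in> S \<Longrightarrow> P E < d \<Longrightarrow> Q E < r / 2"
      by (rule abs_cont_eps_delta[OF fa_probD(1)[OF S P] ac, of "r / 2"]) (use r in auto)
    \<comment> \<open>\<open>K\<^sup>2\<close> is the cutoff for the ratio of \<open>Q\<close> to
      \<open>P\<close>: the cells above it have total \<open>P\<close>-mass at most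
      \<open>1 / K\<^sup>2 = d / 2\<close>, strictly below \<open>d\<close>.\<close>
    define K where "K = sqrt (2 / d)"
    have K: "K > 0" "K\<^sup>2 = 2 / d" using d by (auto simp: K_def)
    \<comment> \<open>Calibrated so that an excess \<open>\<Phi> t - L\<close> below
      \<open>r / 2 * c\<close> bounds \<open>K\<close> times the affinity of the bad cells by
      \<open>r / 2\<close>.\<close>
    define c where "c = \<epsilon>\<^sup>2 / 4 / K"
    have c: "c > 0" using e K by (simp add: c_def)
    have "r / 2 * c > 0" using r c by simp
    then obtain N where N: "\<And>t. t \<ge> N \<Longrightarrow> \<Phi> t - L < r / 2 * c"
      using LIMSEQ_D[OF L(1), of "r / 2 * c"] by fastforce
    have "norm (Q (bad_set S P Q \<epsilon> t) - 0) < r" if t: "t \<ge> N" for t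
    proof -
      define B where "B = {A \<in> Pow {..<t}. (\<lambda>i. i \<in> A) \<in> bad_set S P Q \<epsilon> t}"
      define H where "H = {A \<in> Pow {..<t}. Q (cell t A) > K\<^sup>2 * P (cell t A)}"
      let ?h = "\<lambda>A. sqrt (P (cell t A) * Q (cell t A))"
      have fin: "finite B" "finite H" by (auto simp: B_def H_def)
      have bad: "bad_set S P Q \<epsilon> t = \<Union> (cell t ` B)"
        unfolding B_def by (rule bad_set_eq_Union_cells)
      then have bS: "bad_set S P Q \<epsilon> t \<in> S" using clS Union_cells_clopen by metis
      have HS: "\<Union> (cell t ` H) \<in> S" using clS Union_cells_clopen by metis
      have QH: "Q (\<Union> (cell t ` H)) < r / 2"
      proof (rule d(2)[OF HS])
        have "K\<^sup>2 * P (\<Union> (cell t ` H)) = (\<Sum>A\<in>H. K\<^sup>2 * P (cell t A))"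
          by (subst un[OF P]) (auto simp: H_def sum_distrib_left)
        also have "\<dots> \<le> (\<Sum>A\<in>H. Q (cell t A))" by (rule sum_mono) (simp add: H_def)
        also have "\<dots> = Q (\<Union> (cell t ` H))" by (subst un[OF Q]) (auto simp: H_def)
        also have "\<dots> \<le> 1" by (rule fa_probD(7)[OF S Q HS])
        finally have "P (\<Union> (cell t ` H)) \<le> d / 2" using d(1) K by (simp add: field_simps)
        then show "P (\<Union> (cell t ` H)) < d" using d(1) by linarith
      qed
      \<comment> \<open>Below the cutoff, multiplying the ratio bound by \<open>Q (cell t A)\<close>
        and taking roots bounds mass by affinity.\<close>
      have le: "Q (cell t A) \<le> K * ?h A" if "A \<in> B - H" for A
      proof -
        have "Q (cell t A) \<le> K\<^sup>2 * P (cell t A)" using that by (auto simp: H_def B_def)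
        then have "(Q (cell t A))\<^sup>2 \<le> K\<^sup>2 * (P (cell t A) * Q (cell t A))"
          using nn[of t A] mult_right_mono by (fastforce simp: power2_eq_square mult.assoc)
        then have "Q (cell t A) \<le> sqrt (K\<^sup>2 * (P (cell t A) * Q (cell t A)))" by (rule real_le_rsqrt)
        then show ?thesis using K(1) by (simp add: real_sqrt_mult)
      qed
      have "Q (bad_set S P Q \<epsilon> t) = (\<Sum>A\<in>B \<inter> H. Q (cell t A)) + (\<Sum>A\<in>B - H. Q (cell t A))"
        unfolding bad by (subst un[OF Q]) (auto simp: B_def intro!: sum.Int_Diff)
      also have "\<dots> \<le> (\<Sum>A\<in>H. Q (cell t A)) + (\<Sum>A\<in>B. K * ?h A)"
      proof (rule add_mono)
        show "(\<Sum>A\<in>B \<inter> H. Q (cell t A)) \<le> (\<Sum>A\<in>H. Q (cell t A))"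
          by (rule sum_mono2) (auto simp: fin nn)
        have "(\<Sum>A\<in>B - H. Q (cell t A)) \<le> (\<Sum>A\<in>B - H. K * ?h A)" by (rule sum_mono[OF le])
        also have "\<dots> \<le> (\<Sum>A\<in>B. K * ?h A)"
          using K by (intro sum_mono2) (auto simp: fin nn)
        finally show "(\<Sum>A\<in>B - H. Q (cell t A)) \<le> (\<Sum>A\<in>B. K * ?h A)" .
      qed
      also have "(\<Sum>A\<in>H. Q (cell t A)) = Q (\<Union> (cell t ` H))" by (subst un[OF Q]) (auto simp: H_def)
      also have "(\<Sum>A\<in>B. K * ?h A) \<le> r / 2"
      proof -
        have "(\<Sum>A\<in>B. ?h A) * (\<epsilon>\<^sup>2 / 4) \<le> \<Phi> t - L"
          unfolding \<Phi>_def
          by (rule bad_cells_hellinger_bound[OF adm P Q dense ac L(2)[unfolded \<Phi>_def] e B_def])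
        then have "(\<Sum>A\<in>B. ?h A) * K * c \<le> r / 2 * c"
          using N[OF t] K(1) by (simp add: c_def)
        then show ?thesis using c by (simp add: sum_distrib_left[symmetric] mult.commute)
      qed
      finally show ?thesis using QH fa_probD(1)[OF S Q bS] by simp
    qed
    then show "\<exists>N. \<forall>t\<ge>N. norm (Q (bad_set S P Q \<epsilon> t) - 0) < r" by blast
  qed
qed

subsection \<open>Strong nonatomicity\<close>

text \<open>The paths that precede \<open>x\<close> lexicographically and first differ from it
  before coordinate \<open>n\<close>.\<close>

definition lex_left :: "path \<Rightarrow> nat \<Rightarrow> path set" where
  "lex_left x n = {\<omega>. \<exists>k<n. (\<forall>i<k. \<omega> i = x i) \<and> x k \<and> \<not> \<omega> k}"

lemma lex_left_cong: "(\<And>i. i < n \<Longrightarrow> x i = y i) \<Longrightarrow> lex_left x n = lex_left y n"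
  by (auto simp: lex_left_def)

lemma lex_left_clopen: "lex_left x n \<in> clopens"
  unfolding clopens_def lex_left_def
  by (intro CollectI exI[of _ n] allI impI) (auto; metis order.strict_trans)

text \<open>The path \<open>x\<close> is found bit by bit as the quantile of \<open>P\<close> restricted to \<open>E\<close> in the lexicographic
  order; the witness is the part of \<open>E\<close> to the left of \<open>x\<close>.\<close>

lemma strongly_nonatomic_of_small_cylinders:
  assumes adm: "admissible_sigma S" and P: "fa_prob S P"
    and small: "\<And>\<omega> t. P (cyl \<omega> t) \<le> 1 / 2 ^ t"
  shows "strongly_nonatomic S P"
  unfolding strongly_nonatomic_def
proof (intro ballI allI impI, elim conjE)
  fix E and \<alpha> :: real assume E: "E \<in> S" and \<alpha>: "0 \<le> \<alpha>" "\<alpha> \<le> 1"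
  have S: "sigma_algebra UNIV S" using adm by (simp add: admissible_sigma_def)
  interpret sigma_algebra UNIV S by (rule S)
  note D = fa_probD[OF S P]
  have cS: "cyl x n \<in> S" for x n using adm by (simp add: admissible_sigma_def)
  have lS: "lex_left x n \<in> S" for x n by (rule clopen_in_sigma[OF adm lex_left_clopen])
  define a where "a = \<alpha> * P E"
  have a: "0 \<le> a" "a \<le> P E"
    using \<alpha> D(1)[OF E] by (auto simp: a_def intro: mult_left_le_one_le)
  \<comment> \<open>Bisection invariant: the target \<open>a\<close> is reached somewhere inside the
    cylinder of \<open>x\<close>, counting mass of \<open>E\<close> from the left.\<close>
  define Inv where "Inv n x \<longleftrightarrow> P (E \<inter> lex_left x n) \<le> a \<and>
     a \<le> P (E \<inter> lex_left x n) + P (E \<inter> cyl x n)" for n x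
  have "\<exists>s. \<forall>n. Inv n (s n) \<and> (\<forall>i<n. s (Suc n) i = s n i)"
  proof (rule dependent_nat_choice)
    \<comment> \<open>At level 0 nothing lies to the left and the cylinder is the whole
      space.\<close>
    have "Inv 0 (\<lambda>_. False)" using a D(3) by (simp add: Inv_def lex_left_def cyl_def)
    then show "\<exists>x. Inv 0 x" by blast
  next
    fix x n assume inv: "Inv n x"
    let ?T = "{\<omega>. \<omega> n} :: path set"
    let ?m = "P (E \<inter> (cyl x n - ?T))"
    \<comment> \<open>The next bit is 1 exactly when adding the 0-half of the cylinder still falls
      short of \<open>a\<close>; that half then joins the left part.\<close>
    define b where "b \<longleftrightarrow> P (E \<inter> lex_left x n) + ?m < a"
    define y where "y = x(n := b)"
    have "?T \<in> clopens" by (auto simp: clopens_def)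
    then have TS: "?T \<in> S" by (rule clopen_in_sigma[OF adm])
    have split: "P (E \<inter> cyl x n) = P (E \<inter> (cyl x n \<inter> ?T)) + ?m"
      using D(5)[of "E \<inter> cyl x n" ?T] E cS TS by (auto simp: Int_assoc Int_Diff)
    have "Inv (Suc n) y"
    proof (cases b)
      case True
      have l: "lex_left y (Suc n) = lex_left x n \<union> (cyl x n - ?T)"
        using True by (auto simp: lex_left_def y_def cyl_def less_Suc_eq)
      have c: "cyl y (Suc n) = cyl x n \<inter> ?T"
        using True by (auto simp: y_def cyl_def less_Suc_eq)
      have "cyl x n - ?T \<in> S" using cS TS by blast
      moreover have "lex_left x n \<inter> cyl x n = {}" by (auto simp: lex_left_def cyl_def)
      ultimately have "P (E \<inter> lex_left y (Suc n)) = P (E \<inter> lex_left x n) + ?m"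
        unfolding l Int_Un_distrib using E lS by (intro D(4)) auto
      then show ?thesis using True inv split unfolding Inv_def c b_def by linarith
    next
      case False
      have l: "lex_left y (Suc n) = lex_left x n"
        using False by (auto simp: lex_left_def y_def less_Suc_eq)
      have c: "cyl y (Suc n) = cyl x n - ?T"
        using False by (auto simp: y_def cyl_def less_Suc_eq)
      show ?thesis using False inv unfolding Inv_def l c b_def by linarith
    qed
    then show "\<exists>y. Inv (Suc n) y \<and> (\<forall>i<n. y i = x i)"
      by (intro exI[of _ y]) (simp add: y_def)
  qed
  then obtain s where s: "\<And>n. Inv n (s n)" "\<And>n i. i < n \<Longrightarrow> s (Suc n) i = s n i" by blast
  \<comment> \<open>Later choices preserve earlier bits, so bit \<open>i\<close> is settled from
    \<open>s (Suc i)\<close> on.\<close>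
  define x where "x = (\<lambda>i. s (Suc i) i)"
  have sx: "s n i = x i" if "i < n" for n i
    using that
  proof (induction n)
    case (Suc n)
    then show ?case using s(2)[of i n] by (cases "i = n") (auto simp: x_def)
  qed simp
  have inv: "Inv n x" for n
  proof -
    have "lex_left (s n) n = lex_left x n" by (rule lex_left_cong) (rule sx)
    moreover have "cyl (s n) n = cyl x n" using sx[of _ n] by (auto simp: cyl_def)
    ultimately show ?thesis using s(1)[of n] by (simp add: Inv_def)
  qed
  define F where "F = E \<inter> (\<Union>n. lex_left x n)"
  have F: "F \<in> S" unfolding F_def using E lS by blast
  \<comment> \<open>\<open>P\<close> need not be countably additive, so \<open>P F\<close> is not
    computed as a limit. Instead \<open>F\<close> is squeezed between
    \<open>E \<inter> lex_left x n\<close> and its union with a part of \<open>cyl x n\<close>,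
    whose mass is at most \<open>1 / 2 ^ n\<close>.\<close>
  have near: "\<bar>P F - a\<bar> \<le> 1 / 2 ^ n" for n
  proof -
    have lo: "P (E \<inter> lex_left x n) \<le> P F" using E lS F by (intro D(6)) (auto simp: F_def)
    have "F \<subseteq> (E \<inter> lex_left x n) \<union> (E \<inter> cyl x n)"
    proof
      fix \<omega> assume "\<omega> \<in> F"
      then obtain k where k: "\<omega> \<in> E" "\<forall>i<k. \<omega> i = x i" "x k" "\<not> \<omega> k"
        by (auto simp: F_def lex_left_def)
      then show "\<omega> \<in> (E \<inter> lex_left x n) \<union> (E \<inter> cyl x n)"
        by (cases "k < n") (auto simp: lex_left_def cyl_def)
    qed
    then have "P F \<le> P ((E \<inter> lex_left x n) \<union> (E \<inter> cyl x n))"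
      using E lS cS F by (intro D(6) Un Int) auto
    also have "\<dots> = P (E \<inter> lex_left x n) + P (E \<inter> cyl x n)"
      using E lS cS by (intro D(4)) (auto simp: lex_left_def cyl_def)
    finally have hi: "P F \<le> P (E \<inter> lex_left x n) + P (E \<inter> cyl x n)" .
    have "P (E \<inter> cyl x n) \<le> 1 / 2 ^ n"
      using D(6)[of "E \<inter> cyl x n" "cyl x n"] E cS small[of x n] by fastforce
    then show ?thesis using lo hi inv[of n] unfolding Inv_def by linarith
  qed
  have "(\<lambda>n. 1 / 2 ^ n :: real) \<longlonglongrightarrow> 0"
    using LIMSEQ_realpow_zero[of "1/2 :: real"] by (simp add: power_divide)
  then have "\<bar>P F - a\<bar> \<le> 0" by (rule LIMSEQ_le_const) (use near in auto)
  then show "\<exists>F\<in>S. F \<subseteq> E \<and> P F = \<alpha> * P E"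
    using F by (intro bexI[of _ F]) (auto simp: F_def a_def)
qed

theorem theorem4:
  fixes S :: "path set set" and I :: "path set set"
  assumes "admissible_sigma S"
    and "strictly_proper_ideal I"
  shows "\<exists>P\<in>Delta_BD S. \<forall>E\<in>I \<inter> S. P E = 0"
proof -
  obtain P :: "path set \<Rightarrow> real" where P:
    "\<And>X. 0 \<le> P X" "P UNIV = 1" "\<And>X Y. P (X \<union> Y) + P (X \<inter> Y) = P X + P Y" "P {} = 0"
    "\<And>\<omega> t. P (cyl \<omega> t) \<le> 1 / 2 ^ t" "\<And>X. X \<in> I \<Longrightarrow> P X = 0"
    "\<And>X e. e > 0 \<Longrightarrow> \<exists>F\<in>clopens. P (X - F) < e \<and> P (F - X) < e"
    by (rule uniform_charge_null_on_ideal[OF assms(2)]) blast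
  have "P (E \<union> F) = P E + P F" if "E \<inter> F = {}" for E F
    using P(3)[of E F] P(4) that by simp
  then have fa: "fa_prob S P" using P(1,2) by (simp add: fa_prob_def)
  then have "P \<in> Delta_BD S"
    unfolding Delta_BD_def
    using strongly_nonatomic_of_small_cylinders[OF assms(1) fa P(5)]
      blackwell_dubins_of_clopen_dense[OF assms(1) fa P(7)] by blast
  then show ?thesis using P(6) by blast
qed

end
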